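(* Let $\Phi\in\mathbb{R}^{n\times m}$ with $m>n$ and let $k$ be a positive integer. Suppose that a matrix $W$ (with $n$ columns and an arbitrary number of rows) and a full-rank diagonal matrix $D\in\mathbb{R}^{m\times m}$ jointly attain the infimum in $$\delta^*_{3k}[\Phi] \triangleq \inf_{W,D}\ \delta_{3k}[W\Phi D],$$ and set $\Gamma = D\Phi^\top W^\top W$. Let $x^*\in\mathbb{R}^m$ satisfy $\|x^*\|_0\le k$, let $y=\Phi x^*$, and consider the modified IHT iteration in which the dictionary $\Phi$ is replaced by the column-rescaled dictionary $\Phi D$: $\widetilde{x}^{(0)}=0$ and $$\widetilde{x}^{(t+1)} = H_k\left[(I-\Gamma\Phi D)\,\widetilde{x}^{(t)} + \Gamma y\right],\qquad t=0,1,2,\dots$$ Let $x^{(t)} = D\,\widetilde{x}^{(t)}$ be the corresponding estimates in the original coordinates. If $\delta^*_{3k}[\Phi] < 1/\sqrt{32}$, then for every iteration $t$, $$\left\|D^{-1}x^{(t)} - D^{-1}x^*\right\|_2 \le 2^{-t}\left\|D^{-1}x^*\right\|_2 .$$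
   Context: $\|x\|_0$ denotes the number of nonzero entries of $x$. For a matrix $M$ with $m$ columns, the restricted isometry constant $\delta_s[M]$ is the smallest $\delta\ge 0$ such that $(1-\delta)\|x\|_2^2\le\|Mx\|_2^2\le(1+\delta)\|x\|_2^2$ for all $x\in\mathbb{R}^m$ with $\|x\|_0\le s$. In the infimum defining $\delta^*_{3k}[\Phi]$, $W$ ranges over all real matrices with $n$ columns (any number of rows) and $D$ over all full-rank (invertible) diagonal $m\times m$ matrices. $H_k[\cdot]$ is the hard-thresholding operator on $\mathbb{R}^m$ that keeps the $k$ entries of largest magnitude and sets all other entries to zero. *)

theory Defs
  imports
    "HOL-Analysis.L2_Norm"
    "Jordan_Normal_Form.Matrix"
    "Jordan_Normal_Form.Gauss_Jordan_Elimination"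
begin

definition l0_norm :: "real vec \<Rightarrow> nat" where
  "l0_norm x = card {i. i < dim_vec x \<and> x $ i \<noteq> 0}"

definition l2_norm :: "real vec \<Rightarrow> real" where
  "l2_norm x = L2_set (\<lambda>i. x $ i) {..<dim_vec x}"

definition rip_bound :: "nat \<Rightarrow> real mat \<Rightarrow> real \<Rightarrow> bool" where
  "rip_bound s M \<delta> \<longleftrightarrow> 0 \<le> \<delta> \<and>
     (\<forall>x \<in> carrier_vec (dim_col M). l0_norm x \<le> s \<longrightarrow>
        (1 - \<delta>) * (l2_norm x)\<^sup>2 \<le> (l2_norm (M *\<^sub>v x))\<^sup>2 \<and>
        (l2_norm (M *\<^sub>v x))\<^sup>2 \<le> (1 + \<delta>) * (l2_norm x)\<^sup>2)"

definition restricted_isometry_constant :: "nat \<Rightarrow> real mat \<Rightarrow> real" where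
  "restricted_isometry_constant s M = (LEAST \<delta>. rip_bound s M \<delta>)"

lemma l2_norm_sq: "(l2_norm x)\<^sup>2 = (\<Sum>i<dim_vec x. (x $ i)\<^sup>2)"
  by (simp add: l2_norm_def L2_set_def sum_nonneg)

lemma mult_mat_vec_l2_bound:
  assumes x: "x \<in> carrier_vec (dim_col M)"
  shows "(l2_norm (M *\<^sub>v x))\<^sup>2 \<le> (\<Sum>i<dim_row M. (l2_norm (row M i))\<^sup>2) * (l2_norm x)\<^sup>2"
proof -
  have "(row M i \<bullet> x)\<^sup>2 \<le> (l2_norm (row M i))\<^sup>2 * (l2_norm x)\<^sup>2" if "i < dim_row M" for i
  proof -
    have "\<bar>row M i \<bullet> x\<bar> \<le> (\<Sum>j<dim_col M. \<bar>row M i $ j\<bar> * \<bar>x $ j\<bar>)"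
      unfolding scalar_prod_def abs_mult[symmetric] using x
      by (simp add: lessThan_atLeast0 sum_abs)
    also have "\<dots> \<le> l2_norm (row M i) * l2_norm x"
      using L2_set_mult_ineq[of "\<lambda>j. row M i $ j" "\<lambda>j. x $ j" "{..<dim_col M}"] x
      by (simp add: l2_norm_def)
    finally show ?thesis
      unfolding power_mult_distrib[symmetric]
      by (meson abs_ge_self abs_le_square_iff order_trans)
  qed
  then have "(\<Sum>i<dim_row M. (row M i \<bullet> x)\<^sup>2)
      \<le> (\<Sum>i<dim_row M. (l2_norm (row M i))\<^sup>2 * (l2_norm x)\<^sup>2)"
    by (intro sum_mono) simp
  then show ?thesis
    by (simp add: l2_norm_sq[of "M *\<^sub>v x"] sum_distrib_right)
qed

text \<open>The least admissible constant always exists, so the constant above is never a junk value of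
  the operator \<open>LEAST\<close>.\<close>

lemma rip_bound_restricted_isometry_constant:
  "rip_bound s M (restricted_isometry_constant s M)"
  and restricted_isometry_constant_le:
  "rip_bound s M \<delta> \<Longrightarrow> restricted_isometry_constant s M \<le> \<delta>"
proof -
  define A where "A = {\<delta>. rip_bound s M \<delta>}"
  define C where "C = (\<Sum>i<dim_row M. (l2_norm (row M i))\<^sup>2)"
  have C0: "C \<ge> 0" unfolding C_def by (intro sum_nonneg) simp
  have "rip_bound s M (1 + C)"
    unfolding rip_bound_def
  proof (intro conjI ballI impI)
    fix x :: "real vec" assume x: "x \<in> carrier_vec (dim_col M)"
    have p: "0 \<le> C * (l2_norm x)\<^sup>2"
      using C0 by simp
    show "(1 - (1 + C)) * (l2_norm x)\<^sup>2 \<le> (l2_norm (M *\<^sub>v x))\<^sup>2"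
      by (rule order_trans[of _ 0]) (use p in \<open>simp_all add: algebra_simps\<close>)
    show "(l2_norm (M *\<^sub>v x))\<^sup>2 \<le> (1 + (1 + C)) * (l2_norm x)\<^sup>2"
      by (rule order_trans[OF mult_mat_vec_l2_bound[OF x]], fold C_def, rule mult_right_mono) simp_all
  qed (use C0 in simp)
  then have ne: "A \<noteq> {}" unfolding A_def by blast
  have bdd: "bdd_below A" unfolding A_def by (intro bdd_belowI[of _ 0]) (simp add: rip_bound_def)
  have low: "Inf A \<le> \<delta>" if "rip_bound s M \<delta>" for \<delta>
    using that bdd by (intro cInf_lower) (simp_all add: A_def)
  have bd: "rip_bound s M (Inf A)"
    unfolding rip_bound_def
  proof (intro conjI ballI impI)
    show "0 \<le> Inf A" by (rule cInf_greatest[OF ne]) (simp add: A_def rip_bound_def)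
    fix x :: "real vec" assume x: "x \<in> carrier_vec (dim_col M)" "l0_norm x \<le> s"
    define N where "N = (l2_norm x)\<^sup>2"
    define L where "L = (l2_norm (M *\<^sub>v x))\<^sup>2"
    have N0: "N \<ge> 0" by (simp add: N_def)
    have *: "(1 - \<delta>) * N \<le> L \<and> L \<le> (1 + \<delta>) * N" if "\<delta> \<in> A" for \<delta>
      using that x by (auto simp: A_def rip_bound_def N_def L_def)
    have "(1 - Inf A) * N \<le> L \<and> L \<le> (1 + Inf A) * N"
    proof (cases "N = 0")
      case True
      with ne * show ?thesis by auto
    next
      case False
      then have N: "N > 0" using N0 by simp
      have "1 - L / N \<le> \<delta> \<and> L / N - 1 \<le> \<delta>" if "\<delta> \<in> A" for \<delta>
        using *[OF that] N by (simp add: field_simps)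
      then have "1 - L / N \<le> Inf A" "L / N - 1 \<le> Inf A"
        using cInf_greatest[OF ne] by blast+
      with N show ?thesis by (simp add: field_simps)
    qed
    then show "(1 - Inf A) * (l2_norm x)\<^sup>2 \<le> (l2_norm (M *\<^sub>v x))\<^sup>2"
      "(l2_norm (M *\<^sub>v x))\<^sup>2 \<le> (1 + Inf A) * (l2_norm x)\<^sup>2"
      by (simp_all add: N_def L_def)
  qed
  have eq: "restricted_isometry_constant s M = Inf A"
    unfolding restricted_isometry_constant_def by (rule Least_equality) (fact bd low)+
  show "rip_bound s M (restricted_isometry_constant s M)" using bd eq by simp
  show "restricted_isometry_constant s M \<le> \<delta>" if "rip_bound s M \<delta>" using low[OF that] eq by simp
qed

definition optimal_ric :: "nat \<Rightarrow> real mat \<Rightarrow> real" where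
  "optimal_ric s \<Phi> =
     Inf {restricted_isometry_constant s (W * \<Phi> * D) | p W D.
            W \<in> carrier_mat p (dim_row \<Phi>) \<and>
            D \<in> carrier_mat (dim_col \<Phi>) (dim_col \<Phi>) \<and> diagonal_mat D \<and> invertible_mat D}"

text \<open>Entries of equal magnitude make the hard-thresholding operator ambiguous; the predicate admits
  every operator that resolves ties by an arbitrary choice. If \<open>k > m\<close>, all entries are kept.\<close>

definition hard_thresholding_operator :: "nat \<Rightarrow> nat \<Rightarrow> (real vec \<Rightarrow> real vec) \<Rightarrow> bool" where
  "hard_thresholding_operator m k H \<longleftrightarrow>
     (\<forall>v \<in> carrier_vec m. \<exists>S \<subseteq> {..<m}. card S = min k m \<and>
        (\<forall>i \<in> S. \<forall>j \<in> {..<m} - S. \<bar>v $ j\<bar> \<le> \<bar>v $ i\<bar>) \<and>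
        H v = vec m (\<lambda>i. if i \<in> S then v $ i else 0))"

end

theory Submission
  imports Defs
begin

text \<open>In the rescaled coordinates the iteration is ordinary iterative hard thresholding
  \<open>w \<mapsto> H (w + A\<^sup>T A (z - w))\<close> for \<open>A = W \<Phi> D\<close> with target \<open>z = D\<^sup>-\<^sup>1 x\<^sup>*\<close>. Let \<open>b\<close> be the
  argument of \<open>H\<close> and \<open>T\<close> the union of the kept indices and the support of \<open>z\<close>. On \<open>T\<close> the vector
  \<open>H b\<close> is at least as close to \<open>b\<close> as \<open>z\<close> is, so the new error is at most twice the norm of
  \<open>b - z = (I - A\<^sup>T A) (w - z)\<close> on \<open>T\<close>. Adding the support of \<open>w\<close> gives at most \<open>3 k\<close> indices, and on
  these the restricted isometry property bounds that norm by \<open>\<delta> \<parallel>w - z\<parallel>\<close>. Hence the error contracts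
  by \<open>2 \<delta> < 1 / 2\<close>.\<close>

section \<open>Norm identities and the Gram matrix\<close>

lemma l2_norm_nonneg [simp]: "0 \<le> l2_norm x"
  by (simp add: l2_norm_def)

lemma l2_norm_sq_add:
  assumes "u \<in> carrier_vec n" "v \<in> carrier_vec n"
  shows "(l2_norm (u + v))\<^sup>2 = (l2_norm u)\<^sup>2 + 2 * (u \<bullet> v) + (l2_norm v)\<^sup>2"
  using assms
  by (simp add: l2_norm_sq scalar_prod_def power2_sum lessThan_atLeast0 sum.distrib
      sum_distrib_left algebra_simps)

lemma l2_norm_sq_minus:
  assumes "u \<in> carrier_vec n" "v \<in> carrier_vec n"
  shows "(l2_norm (u - v))\<^sup>2 = (l2_norm u)\<^sup>2 - 2 * (u \<bullet> v) + (l2_norm v)\<^sup>2"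
  using assms
  by (simp add: l2_norm_sq scalar_prod_def power2_diff lessThan_atLeast0 sum.distrib sum_subtractf
      sum_distrib_left algebra_simps)

lemma gram_mult_vec_carrier:
  assumes "A \<in> carrier_mat p m" "u \<in> carrier_vec m"
  shows "A\<^sup>T *\<^sub>v (A *\<^sub>v u) \<in> carrier_vec m"
  using assms by (meson mult_mat_vec_carrier transpose_carrier_mat)

lemma gram_mult_vec_minus:
  fixes A :: "'a :: ring mat"
  assumes A: "A \<in> carrier_mat p m" and u: "u \<in> carrier_vec m" and v: "v \<in> carrier_vec m"
  shows "A\<^sup>T *\<^sub>v (A *\<^sub>v (u - v)) = A\<^sup>T *\<^sub>v (A *\<^sub>v u) - A\<^sup>T *\<^sub>v (A *\<^sub>v v)"
proof -
  have "A\<^sup>T \<in> carrier_mat m p" "A *\<^sub>v u \<in> carrier_vec p" "A *\<^sub>v v \<in> carrier_vec p"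
    using assms by auto
  then show ?thesis
    using mult_minus_distrib_mat_vec[OF assms] mult_minus_distrib_mat_vec by metis
qed

section \<open>Sparsity and restricted isometry estimates\<close>

lemma l0_norm_le_card:
  assumes "finite U" "\<And>i. i < dim_vec x \<Longrightarrow> i \<notin> U \<Longrightarrow> x $ i = 0"
  shows "l0_norm x \<le> card U"
  unfolding l0_norm_def using assms by (intro card_mono) auto

lemma rip_bound_mono:
  assumes "rip_bound s M \<delta>" "\<delta> \<le> \<epsilon>"
  shows "rip_bound s M \<epsilon>"
  unfolding rip_bound_def
proof (intro conjI ballI impI)
  show "0 \<le> \<epsilon>" using assms by (simp add: rip_bound_def)
  fix x :: "real vec" assume x: "x \<in> carrier_vec (dim_col M)" "l0_norm x \<le> s"
  have "(1 - \<epsilon>) * (l2_norm x)\<^sup>2 \<le> (1 - \<delta>) * (l2_norm x)\<^sup>2"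
    "(1 + \<delta>) * (l2_norm x)\<^sup>2 \<le> (1 + \<epsilon>) * (l2_norm x)\<^sup>2"
    using assms(2) by (simp_all add: mult_right_mono)
  then show "(1 - \<epsilon>) * (l2_norm x)\<^sup>2 \<le> (l2_norm (M *\<^sub>v x))\<^sup>2"
    "(l2_norm (M *\<^sub>v x))\<^sup>2 \<le> (1 + \<epsilon>) * (l2_norm x)\<^sup>2"
    using assms(1) x unfolding rip_bound_def by force+
qed

text \<open>Polarization: the quadratic form of the identity minus the Gram matrix is bounded by
  \<open>\<delta>\<close> on vectors supported in \<open>U\<close>, hence so is its bilinear form.\<close>

lemma rip_bilinear_bound:
  assumes A: "A \<in> carrier_mat p m" and rip: "rip_bound s A \<delta>"
    and U: "finite U" "card U \<le> s"
    and u: "u \<in> carrier_vec m" "\<And>i. i < m \<Longrightarrow> i \<notin> U \<Longrightarrow> u $ i = 0"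
    and v: "v \<in> carrier_vec m" "\<And>i. i < m \<Longrightarrow> i \<notin> U \<Longrightarrow> v $ i = 0"
  shows "2 * (u \<bullet> v - (A *\<^sub>v u) \<bullet> (A *\<^sub>v v)) \<le> \<delta> * ((l2_norm u)\<^sup>2 + (l2_norm v)\<^sup>2)"
proof -
  have Au: "A *\<^sub>v u \<in> carrier_vec p" and Av: "A *\<^sub>v v \<in> carrier_vec p"
    using A u(1) v(1) by auto
  have "l0_norm (u + v) \<le> s" "l0_norm (u - v) \<le> s"
    using u v by (auto intro!: order_trans[OF l0_norm_le_card[OF U(1)] U(2)])
  \<comment> \<open>The lower bound for the sum and the upper bound for the difference are
    subtracted; the squares of norms leave four times each inner product and, on the side of
    \<open>\<delta>\<close>, the parallelogram sum.\<close>
  then have "(1 - \<delta>) * (l2_norm (u + v))\<^sup>2 \<le> (l2_norm (A *\<^sub>v (u + v)))\<^sup>2"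
    "(l2_norm (A *\<^sub>v (u - v)))\<^sup>2 \<le> (1 + \<delta>) * (l2_norm (u - v))\<^sup>2"
    using rip A u(1) v(1) unfolding rip_bound_def by auto
  then show ?thesis
    using A u(1) v(1)
    by (simp add: mult_add_distrib_mat_vec[OF A] mult_minus_distrib_mat_vec[OF A]
        l2_norm_sq_add[OF u(1) v(1)] l2_norm_sq_minus[OF u(1) v(1)]
        l2_norm_sq_add[OF Au Av] l2_norm_sq_minus[OF Au Av] algebra_simps)
qed

text \<open>Duality: with \<open>u\<close> the restriction of the residual \<open>g\<close> to
  \<open>U\<close>, the square of its norm is \<open>u \<bullet> g\<close>, which is the bilinear
  form of the identity minus the Gram matrix at \<open>u\<close> and \<open>r\<close>, both
  supported in \<open>U\<close>.\<close>

lemma rip_residual_bound: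
  assumes A: "A \<in> carrier_mat p m" and rip: "rip_bound s A \<delta>"
    and U: "U \<subseteq> {..<m}" "card U \<le> s"
    and r: "r \<in> carrier_vec m" "\<And>i. i < m \<Longrightarrow> i \<notin> U \<Longrightarrow> r $ i = 0"
  shows "L2_set (\<lambda>i. (r - A\<^sup>T *\<^sub>v (A *\<^sub>v r)) $ i) U \<le> \<delta> * l2_norm r"
proof -
  define g where "g = r - A\<^sup>T *\<^sub>v (A *\<^sub>v r)"
  define u where "u = vec m (\<lambda>i. if i \<in> U then g $ i else 0)"
  have fin: "finite U" using U(1) finite_subset by blast
  have Ar: "A *\<^sub>v r \<in> carrier_vec p" using A r(1) by auto
  have ATAr: "A\<^sup>T *\<^sub>v (A *\<^sub>v r) \<in> carrier_vec m"
    using gram_mult_vec_carrier[OF A r(1)] .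
  have g: "g \<in> carrier_vec m" and u: "u \<in> carrier_vec m"
    using ATAr r(1) by (auto simp: g_def u_def)
  have d0: "0 \<le> \<delta>" using rip by (simp add: rip_bound_def)
  have sq: "(l2_norm u)\<^sup>2 = (\<Sum>i\<in>U. (g $ i)\<^sup>2)"
    unfolding l2_norm_sq using U(1)
    by (intro sum.mono_neutral_cong_right) (auto simp: u_def)
  have "(l2_norm u)\<^sup>2 = u \<bullet> g"
    unfolding l2_norm_sq scalar_prod_def using g
    by (simp add: lessThan_atLeast0) (auto intro!: sum.cong simp: u_def power2_eq_square)
  also have "\<dots> = u \<bullet> r - (A *\<^sub>v u) \<bullet> (A *\<^sub>v r)"
    unfolding g_def scalar_prod_minus_distrib[OF u r(1) ATAr]
    using transpose_vec_mult_scalar[OF A u Ar]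
    by (simp add: comm_scalar_prod[OF u ATAr] comm_scalar_prod[OF Ar mult_mat_vec_carrier[OF A u]])
  finally have bil: "(l2_norm u)\<^sup>2 = u \<bullet> r - (A *\<^sub>v u) \<bullet> (A *\<^sub>v r)" .
  \<comment> \<open>The bilinear bound involves a sum of squares instead of a product of norms.
    Replacing \<open>r\<close> by its multiple by \<open>c\<close> leaves a free weight to
    optimize.\<close>
  have key: "2 * c * (l2_norm u)\<^sup>2 \<le> \<delta> * ((l2_norm u)\<^sup>2 + c\<^sup>2 * (l2_norm r)\<^sup>2)" for c
  proof -
    have cr: "(l2_norm (c \<cdot>\<^sub>v r))\<^sup>2 = c\<^sup>2 * (l2_norm r)\<^sup>2"
      by (simp add: l2_norm_sq power_mult_distrib sum_distrib_left)
    have "u \<bullet> (c \<cdot>\<^sub>v r) - (A *\<^sub>v u) \<bullet> (A *\<^sub>v (c \<cdot>\<^sub>v r)) = c * (l2_norm u)\<^sup>2"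
      using A u r(1) by (simp add: bil mult_mat_vec[OF A r(1)] algebra_simps)
    then show ?thesis
      using rip_bilinear_bound[OF A rip fin U(2) u _ smult_carrier_vec[THEN iffD2, OF r(1), of c]] r
      by (simp add: cr u_def)
  qed
  have "(l2_norm u)\<^sup>2 \<le> (\<delta> * l2_norm r)\<^sup>2"
  \<comment> \<open>The weight \<open>c = \<delta>\<close> absorbs half of the left side but makes
    the inequality trivial for \<open>\<delta> = 0\<close>; there \<open>c = 1\<close> forces
    \<open>u\<close> to have norm zero.\<close>
  proof (cases "\<delta> = 0")
    case True
    then show ?thesis using key[of 1] by simp
  next
    case False
    have "\<delta> * (l2_norm u)\<^sup>2 \<le> \<delta> * (\<delta> * l2_norm r)\<^sup>2"
      using key[of \<delta>] by (simp add: algebra_simps power_mult_distrib)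
    then show ?thesis using False d0 by simp
  qed
  moreover have "L2_set (\<lambda>i. g $ i) U = l2_norm u"
    using sq by (simp add: L2_set_def real_sqrt_unique)
  ultimately show ?thesis
    using power2_le_imp_le[of "l2_norm u" "\<delta> * l2_norm r"] d0 unfolding g_def by simp
qed

section \<open>Hard thresholding and one step of the iteration\<close>

lemma hard_thresholding_operatorE:
  assumes "hard_thresholding_operator m k H" "v \<in> carrier_vec m"
  obtains S where "S \<subseteq> {..<m}" "card S = min k m"
    "\<And>i j. i \<in> S \<Longrightarrow> j < m \<Longrightarrow> j \<notin> S \<Longrightarrow> \<bar>v $ j\<bar> \<le> \<bar>v $ i\<bar>"
    "H v = vec m (\<lambda>i. if i \<in> S then v $ i else 0)"
  using assms unfolding hard_thresholding_operator_def by force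

lemma hard_thresholding_sparse:
  assumes "hard_thresholding_operator m k H" "v \<in> carrier_vec m"
  shows "H v \<in> carrier_vec m" "l0_norm (H v) \<le> k"
proof -
  obtain S where S: "S \<subseteq> {..<m}" "card S = min k m"
    and H: "H v = vec m (\<lambda>i. if i \<in> S then v $ i else 0)"
    using hard_thresholding_operatorE[OF assms] by metis
  show "H v \<in> carrier_vec m" by (simp add: H)
  show "l0_norm (H v) \<le> k"
    using l0_norm_le_card[of S "H v"] S finite_subset[OF S(1)] by (simp add: H)
qed

text \<open>An injection of \<open>A\<close> into \<open>B\<close> compares the sums term by term;
  the terms of \<open>B\<close> outside its image are nonnegative.\<close>

lemma sum_le_sum_dominated:
  fixes f g :: "'a \<Rightarrow> real"
  assumes "finite A" "finite B" "card A \<le> card B"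
    and "\<And>a b. a \<in> A \<Longrightarrow> b \<in> B \<Longrightarrow> f a \<le> g b" and "\<And>b. b \<in> B \<Longrightarrow> 0 \<le> g b"
  shows "sum f A \<le> sum g B"
proof -
  obtain h where h: "inj_on h A" "h ` A \<subseteq> B"
    using card_le_inj[OF assms(1-3)] by blast
  have "sum f A \<le> (\<Sum>a\<in>A. g (h a))"
    using h(2) assms(4) by (intro sum_mono) blast
  also have "\<dots> = sum g (h ` A)" by (simp add: sum.reindex[OF h(1)])
  also have "\<dots> \<le> sum g B" using assms h(2) by (intro sum_mono2) auto
  finally show ?thesis .
qed

text \<open>Thresholding errs only on \<open>Z - S\<close>, while \<open>z\<close> pays the full
  entry of \<open>b\<close> on \<open>S - Z\<close>. The second set is at least as large, and its
  entries of \<open>b\<close> dominate those on the first.\<close>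

lemma thresholding_best_approximation:
  fixes b z :: "'a \<Rightarrow> real"
  assumes fin: "finite S" "finite Z" and card: "card Z \<le> card S"
    and dom: "\<And>i j. i \<in> S \<Longrightarrow> j \<in> Z - S \<Longrightarrow> \<bar>b j\<bar> \<le> \<bar>b i\<bar>"
    and z: "\<And>i. i \<in> S - Z \<Longrightarrow> z i = 0"
  shows "L2_set (\<lambda>i. (if i \<in> S then b i else 0) - b i) (S \<union> Z) \<le> L2_set (\<lambda>i. b i - z i) (S \<union> Z)"
proof -
  have "card (Z - S) \<le> card (S - Z)"
    by (rule card_le_sym_Diff[OF fin(2,1) card])
  then have "(\<Sum>i\<in>Z - S. (b i)\<^sup>2) \<le> (\<Sum>i\<in>S - Z. (b i)\<^sup>2)"
    using fin dom by (intro sum_le_sum_dominated) (auto simp: abs_le_square_iff)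
  also have "\<dots> = (\<Sum>i\<in>S - Z. (b i - z i)\<^sup>2)"
    using z by simp
  also have "\<dots> \<le> (\<Sum>i\<in>S \<union> Z. (b i - z i)\<^sup>2)"
    using fin by (intro sum_mono2) auto
  also have "(\<Sum>i\<in>Z - S. (b i)\<^sup>2) = (\<Sum>i\<in>S \<union> Z. ((if i \<in> S then b i else 0) - b i)\<^sup>2)"
    using fin by (intro sum.mono_neutral_cong_left) auto
  finally show ?thesis by (simp add: L2_set_def)
qed

lemma iht_step:
  assumes A: "A \<in> carrier_mat p m" and rip: "rip_bound (3 * k) A \<delta>"
    and H: "hard_thresholding_operator m k H"
    and z: "z \<in> carrier_vec m" "l0_norm z \<le> k"
    and w: "w \<in> carrier_vec m" "l0_norm w \<le> k"
  shows "l2_norm (H (w + A\<^sup>T *\<^sub>v (A *\<^sub>v (z - w))) - z) \<le> 2 * \<delta> * l2_norm (w - z)"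
proof -
  define b where "b = w + A\<^sup>T *\<^sub>v (A *\<^sub>v (z - w))"
  define Z where "Z = {i. i < m \<and> z $ i \<noteq> 0}"
  define V where "V = {i. i < m \<and> w $ i \<noteq> 0}"
  have b: "b \<in> carrier_vec m" using w gram_mult_vec_carrier[OF A] z by (simp add: b_def)
  obtain S where S: "S \<subseteq> {..<m}" "card S = min k m"
    and dom: "\<And>i j. i \<in> S \<Longrightarrow> j < m \<Longrightarrow> j \<notin> S \<Longrightarrow> \<bar>b $ j\<bar> \<le> \<bar>b $ i\<bar>"
    and Hb: "H b = vec m (\<lambda>i. if i \<in> S then b $ i else 0)"
    using hard_thresholding_operatorE[OF H b] by metis
  have fin: "finite S" "finite Z" "finite V"
    using S finite_subset by (auto simp: Z_def V_def)
  have "card Z \<le> k" "card V \<le> k" using z w by (auto simp: l0_norm_def Z_def V_def)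
  \<comment> \<open>The kept set has \<open>min k m\<close> elements, so the case
    \<open>k > m\<close> requires this second bound.\<close>
  moreover have "card Z \<le> m" using card_mono[of "{..<m}" Z] by (auto simp: Z_def)
  ultimately have cZ: "card Z \<le> card S" and cU: "card (S \<union> Z \<union> V) \<le> 3 * k"
    using S(2) card_Un_le[of S Z] card_Un_le[of "S \<union> Z" V] by auto
  have grams: "A\<^sup>T *\<^sub>v (A *\<^sub>v z) \<in> carrier_vec m" "A\<^sup>T *\<^sub>v (A *\<^sub>v w) \<in> carrier_vec m"
    using A z w by (auto intro: gram_mult_vec_carrier)
  have bz: "(w - z - A\<^sup>T *\<^sub>v (A *\<^sub>v (w - z))) $ i = b $ i - z $ i" if "i < m" for i
    using that z w grams
    by (simp add: b_def gram_mult_vec_minus[OF A z(1) w(1)] gram_mult_vec_minus[OF A w(1) z(1)]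
        carrier_matD[OF A])
  have approx: "L2_set (\<lambda>i. (if i \<in> S then b $ i else 0) - b $ i) (S \<union> Z)
      \<le> L2_set (\<lambda>i. b $ i - z $ i) (S \<union> Z)"
  proof (rule thresholding_best_approximation[OF fin(1,2) cZ])
    show "\<bar>b $ j\<bar> \<le> \<bar>b $ i\<bar>" if "i \<in> S" "j \<in> Z - S" for i j
      using dom[of i j] that by (simp add: Z_def)
    show "z $ i = 0" if "i \<in> S - Z" for i
      using that S(1) by (auto simp: Z_def)
  qed
  \<comment> \<open>The support \<open>V\<close> of \<open>w\<close> is added because the residual
    bound requires \<open>w - z\<close> to vanish outside the index set.\<close>
  have "L2_set (\<lambda>i. b $ i - z $ i) (S \<union> Z) \<le> L2_set (\<lambda>i. b $ i - z $ i) (S \<union> Z \<union> V)"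
    unfolding L2_set_def using fin by (intro real_sqrt_le_mono sum_mono2) auto
  also have "\<dots> = L2_set (\<lambda>i. (w - z - A\<^sup>T *\<^sub>v (A *\<^sub>v (w - z))) $ i) (S \<union> Z \<union> V)"
    using S(1) bz by (intro L2_set_cong) (auto simp: Z_def V_def)
  also have "\<dots> \<le> \<delta> * l2_norm (w - z)"
    using S(1) z(1) w(1)
    by (intro rip_residual_bound[OF A rip _ cU]) (auto simp: Z_def V_def)
  finally have residual: "L2_set (\<lambda>i. b $ i - z $ i) (S \<union> Z) \<le> \<delta> * l2_norm (w - z)" .
  have "l2_norm (H b - z) = L2_set (\<lambda>i. (H b - z) $ i) (S \<union> Z)"
    unfolding l2_norm_def L2_set_def using z S
    by (intro arg_cong[of _ _ sqrt] sum.mono_neutral_right) (auto simp: Hb Z_def)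
  \<comment> \<open>Inserting \<open>b\<close> between \<open>H b\<close> and \<open>z\<close>
    produces the factor 2: both distances are at most the residual on
    \<open>S \<union> Z\<close>.\<close>
  also have "\<dots> = L2_set (\<lambda>i. ((if i \<in> S then b $ i else 0) - b $ i) + (b $ i - z $ i)) (S \<union> Z)"
    using S z by (intro L2_set_cong) (auto simp: Hb Z_def)
  also have "\<dots> \<le> L2_set (\<lambda>i. (if i \<in> S then b $ i else 0) - b $ i) (S \<union> Z)
      + L2_set (\<lambda>i. b $ i - z $ i) (S \<union> Z)"
    by (rule L2_set_triangle_ineq)
  finally show ?thesis using approx residual by (simp add: b_def)
qed

section \<open>Inverses and diagonal matrices\<close>

text \<open>Links the predicate \<open>invertible_mat\<close> to the computed option value: a unit
  of the matrix ring excludes the result \<open>None\<close>, so \<open>the\<close> is applied to a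
  genuine inverse.\<close>

lemma mat_inverse_invertible:
  fixes D :: "'a :: field mat"
  assumes D: "D \<in> carrier_mat m m" and inv: "invertible_mat D"
  shows "the (mat_inverse D) \<in> carrier_mat m m"
    "the (mat_inverse D) * D = 1\<^sub>m m" "D * the (mat_inverse D) = 1\<^sub>m m"
proof -
  obtain E where E: "D * E = 1\<^sub>m m" "E * D = 1\<^sub>m (dim_row E)"
    using inv D by (auto simp: invertible_mat_def inverts_mat_def)
  have "dim_row E = m"
    using arg_cong[OF E(2), of dim_col] D by simp
  moreover have "dim_col E = m"
    using arg_cong[OF E(1), of dim_col] by simp
  \<comment> \<open>The argument \<open>b\<close> fills the record extension slot of
    \<open>ring_mat\<close>.\<close>
  ultimately have "D \<in> Units (ring_mat TYPE('a) m b)" for b :: nat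
    using D E by (auto simp: Units_def ring_mat_def)
  then obtain B where "mat_inverse D = Some B"
    using mat_inverse(1)[OF D, where b = "0 :: nat"] by (cases "mat_inverse D") auto
  then show "the (mat_inverse D) \<in> carrier_mat m m"
    "the (mat_inverse D) * D = 1\<^sub>m m" "D * the (mat_inverse D) = 1\<^sub>m m"
    using mat_inverse(2)[OF D] by auto
qed

lemma diagonal_mat_mult_vec_nth:
  fixes D :: "'a :: semiring_0 mat"
  assumes "D \<in> carrier_mat m m" "diagonal_mat D" "z \<in> carrier_vec m" "i < m"
  shows "(D *\<^sub>v z) $ i = D $$ (i, i) * z $ i"
proof -
  have "(D *\<^sub>v z) $ i = (\<Sum>j\<in>{0..<m}. D $$ (i, j) * z $ j)"
    using assms by (simp add: scalar_prod_def)
  also have "\<dots> = (\<Sum>j\<in>{i}. D $$ (i, j) * z $ j)"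
    using assms by (intro sum.mono_neutral_right) (auto simp: diagonal_mat_def)
  finally show ?thesis by simp
qed

text \<open>A zero on the diagonal would send a unit vector to zero, contradicting the left inverse
  \<open>E\<close>. Scaling by nonzero entries preserves the support.\<close>

lemma l0_norm_diagonal_mult:
  assumes D: "D \<in> carrier_mat m m" "diagonal_mat D" and E: "E \<in> carrier_mat m m" "E * D = 1\<^sub>m m"
    and z: "z \<in> carrier_vec m"
  shows "l0_norm (D *\<^sub>v z) = l0_norm z"
proof -
  have "D $$ (i, i) \<noteq> 0" if i: "i < m" for i
  proof
    assume 0: "D $$ (i, i) = 0"
    have "D *\<^sub>v unit_vec m i = 0\<^sub>v m"
    proof (rule eq_vecI)
      fix j assume "j < dim_vec (0\<^sub>v m)"
      then show "(D *\<^sub>v unit_vec m i) $ j = 0\<^sub>v m $ j"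
        using diagonal_mat_mult_vec_nth[OF D, of "unit_vec m i" j] 0 i by (cases "j = i") auto
    qed (use D in simp)
    then have "E *\<^sub>v (D *\<^sub>v unit_vec m i) = 0\<^sub>v m"
      using E by (intro eq_vecI) auto
    then have "unit_vec m i = (0\<^sub>v m :: real vec)"
      using assoc_mult_mat_vec[OF E(1) D(1), of "unit_vec m i"] E(2) by simp
    then have "unit_vec m i $ i = (0\<^sub>v m :: real vec) $ i" by simp
    then show False using i by simp
  qed
  then have "{i. i < m \<and> (D *\<^sub>v z) $ i \<noteq> 0} = {i. i < m \<and> z $ i \<noteq> 0}"
    using diagonal_mat_mult_vec_nth[OF D z] by auto
  then show ?thesis using D z by (simp add: l0_norm_def)
qed

lemma transpose_diagonal_mat:
  assumes "D \<in> carrier_mat m m" "diagonal_mat D"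
  shows "D\<^sup>T = D"
proof (rule eq_matI)
  fix i j assume "i < dim_row D" "j < dim_col D"
  then show "D\<^sup>T $$ (i, j) = D $$ (i, j)"
    using assms by (cases "i = j") (auto simp: diagonal_mat_def)
qed (use assms in auto)

theorem proposition3:
  fixes \<Phi> W D \<Gamma> :: "real mat"
    and xstar y :: "real vec"
    and H :: "real vec \<Rightarrow> real vec"
    and xt x :: "nat \<Rightarrow> real vec"
    and n m k p :: nat
  assumes "\<Phi> \<in> carrier_mat n m" and "m > n" and "k > 0"
    and "W \<in> carrier_mat p n"
    and "D \<in> carrier_mat m m" and "diagonal_mat D" and "invertible_mat D"
    and "restricted_isometry_constant (3 * k) (W * \<Phi> * D) = optimal_ric (3 * k) \<Phi>"
    and "\<Gamma> = D * \<Phi>\<^sup>T * W\<^sup>T * W"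
    and "xstar \<in> carrier_vec m" and "l0_norm xstar \<le> k"
    and "y = \<Phi> *\<^sub>v xstar"
    and "hard_thresholding_operator m k H"
    and "xt 0 = 0\<^sub>v m"
    and "\<And>t. xt (Suc t) = H ((1\<^sub>m m - \<Gamma> * (\<Phi> * D)) *\<^sub>v xt t + \<Gamma> *\<^sub>v y)"
    and "\<And>t. x t = D *\<^sub>v xt t"
    and "optimal_ric (3 * k) \<Phi> < 1 / sqrt 32"
  shows "\<forall>t. l2_norm (the (mat_inverse D) *\<^sub>v x t - the (mat_inverse D) *\<^sub>v xstar)
               \<le> (1 / 2) ^ t * l2_norm (the (mat_inverse D) *\<^sub>v xstar)"
proof -
  note P = assms(1) and W = assms(4) and D = assms(5,6) and H = assms(13) and xs = assms(10)
  define E where "E = the (mat_inverse D)"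
  define A where "A = W * \<Phi> * D"
  define z where "z = E *\<^sub>v xstar"
  have E: "E \<in> carrier_mat m m" "E * D = 1\<^sub>m m" "D * E = 1\<^sub>m m"
    unfolding E_def by (rule mat_inverse_invertible[OF D(1) assms(7)])+
  have A: "A \<in> carrier_mat p m" using P W D by (simp add: A_def)
  have z: "z \<in> carrier_vec m" using E xs by (simp add: z_def)
  have Dz: "D *\<^sub>v z = xstar"
    using assoc_mult_mat_vec[OF D(1) E(1) xs] E(3) xs by (simp add: z_def)
  have z0: "l0_norm z \<le> k"
    using l0_norm_diagonal_mult[OF D E(1,2) z] Dz assms(11) by simp
  \<comment> \<open>Since 16 is below 32, the threshold lies below 1/4, the constant at which
    \<open>2 * \<delta>\<close> equals the claimed rate 1/2.\<close>
  have ric: "1 / sqrt 32 \<le> (1 / 4 :: real)"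
    by (rule divide_left_mono) (auto intro: real_le_rsqrt)
  \<comment> \<open>Attainment of the infimum transfers the bound on the optimal constant to this
    particular \<open>A\<close>.\<close>
  have "restricted_isometry_constant (3 * k) A \<le> 1 / 4"
    using ric assms(8,17) unfolding A_def by linarith
  then have rip: "rip_bound (3 * k) A (1 / 4)"
    by (rule rip_bound_mono[OF rip_bound_restricted_isometry_constant])
  have t: "W\<^sup>T \<in> carrier_mat n p" "\<Phi>\<^sup>T \<in> carrier_mat m n" using P W by auto
  have G: "\<Gamma> \<in> carrier_mat m n"
    unfolding assms(9) using D(1) t W by (meson mult_carrier_mat)
  have "A\<^sup>T = D * (\<Phi>\<^sup>T * W\<^sup>T)"
    unfolding A_def transpose_mult[OF mult_carrier_mat[OF W P] D(1)] transpose_mult[OF W P]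
      transpose_diagonal_mat[OF D] ..
  \<comment> \<open>Symmetry of the diagonal \<open>D\<close> turns \<open>\<Gamma>\<close> into
    \<open>A\<^sup>T * W\<close>, so that \<open>\<Gamma>\<close> applied after
    \<open>\<Phi> * D\<close> acts as the Gram matrix of \<open>A\<close>.\<close>
  then have "A\<^sup>T * W = \<Gamma>"
    unfolding assms(9) assoc_mult_mat[OF D(1) t(2,1)] by simp
  then have G_mult: "\<Gamma> *\<^sub>v (\<Phi> *\<^sub>v (D *\<^sub>v v)) = A\<^sup>T *\<^sub>v (A *\<^sub>v v)" if v: "v \<in> carrier_vec m" for v
  proof -
    have c: "D *\<^sub>v v \<in> carrier_vec m" "\<Phi> *\<^sub>v (D *\<^sub>v v) \<in> carrier_vec n" "A\<^sup>T \<in> carrier_mat m p"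
      using P D v A by auto
    have "A *\<^sub>v v = W *\<^sub>v (\<Phi> *\<^sub>v (D *\<^sub>v v))"
      unfolding A_def assoc_mult_mat_vec[OF mult_carrier_mat[OF W P] D(1) v]
      by (rule assoc_mult_mat_vec[OF W P c(1)])
    then show ?thesis
      using assoc_mult_mat_vec[OF c(3) W c(2)] \<open>A\<^sup>T * W = \<Gamma>\<close> by simp
  qed
  have step: "(1\<^sub>m m - \<Gamma> * (\<Phi> * D)) *\<^sub>v v + \<Gamma> *\<^sub>v y = v + A\<^sup>T *\<^sub>v (A *\<^sub>v (z - v))"
    if v: "v \<in> carrier_vec m" for v
  proof -
    have PD: "\<Phi> * D \<in> carrier_mat n m" using P D by simp
    have "(1\<^sub>m m - \<Gamma> * (\<Phi> * D)) *\<^sub>v v = v - A\<^sup>T *\<^sub>v (A *\<^sub>v v)"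
      using minus_mult_distrib_mat_vec[OF one_carrier_mat mult_carrier_mat[OF G PD] v]
        assoc_mult_mat_vec[OF G PD v] assoc_mult_mat_vec[OF P D(1) v] G_mult[OF v] v by simp
    \<comment> \<open>The data are rewritten through \<open>D *\<^sub>v z = xstar\<close>, making
      \<open>z\<close> the target in rescaled coordinates.\<close>
    moreover have "\<Gamma> *\<^sub>v y = A\<^sup>T *\<^sub>v (A *\<^sub>v z)"
      using G_mult[OF z] by (simp add: assms(12) Dz)
    moreover have "A\<^sup>T *\<^sub>v (A *\<^sub>v (z - v)) = A\<^sup>T *\<^sub>v (A *\<^sub>v z) - A\<^sup>T *\<^sub>v (A *\<^sub>v v)"
      by (rule gram_mult_vec_minus[OF A z v])
    ultimately show ?thesis
      using v gram_mult_vec_carrier[OF A v] gram_mult_vec_carrier[OF A z]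
      by (intro eq_vecI) auto
  qed
  \<comment> \<open>Sparsity belongs to the invariant because the one-step estimate needs it for the
    current iterate; \<open>H\<close> restores it.\<close>
  have main: "xt t \<in> carrier_vec m \<and> l0_norm (xt t) \<le> k
      \<and> l2_norm (xt t - z) \<le> (1 / 2) ^ t * l2_norm z" for t
  proof (induction t)
    case 0
    have "(l2_norm (0\<^sub>v m - z))\<^sup>2 = (l2_norm z)\<^sup>2"
      using z by (simp add: l2_norm_sq)
    then show ?case using assms(14) l0_norm_le_card[of "{}" "0\<^sub>v m"]
      by (simp add: power2_eq_iff_nonneg)
  next
    case (Suc t)
    let ?b = "xt t + A\<^sup>T *\<^sub>v (A *\<^sub>v (z - xt t))"
    have b: "?b \<in> carrier_vec m" using gram_mult_vec_carrier[OF A] z Suc by simp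
    have eq: "xt (Suc t) = H ?b" using assms(15) step Suc by simp
    have "l2_norm (H ?b - z) \<le> 2 * (1 / 4) * l2_norm (xt t - z)"
      using iht_step[OF A rip H z z0] Suc by blast
    also have "\<dots> \<le> (1 / 2) ^ Suc t * l2_norm z" using Suc by simp
    finally show ?case using eq hard_thresholding_sparse[OF H b] by simp
  qed
  have "E *\<^sub>v x t = xt t" for t
    using assoc_mult_mat_vec[OF E(1) D(1), of "xt t"] E(2) main[of t] assms(16) by simp
  then show ?thesis
    using main by (simp add: z_def E_def)
qed

end
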